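(* Let $n\ge 1$, let $G=A_n$ be the simply connected compact group $SU(n+1)$, let $m$ be a positive integer and $p$ a prime. Write $m=p^i m'$ and $n+1=p^\ell (n+1)'$ with $p$ dividing neither $m'$ nor $(n+1)'$. Then $N(A_n,m,p)$ is the number of tuples $(b_1,\dots,b_n)\in\mathbb{Z}^n$ such that $$p^i>b_1>\dots>b_n>0\quad\text{and}\quad (n+1)'\mid (b_1+\dots+b_n).$$
   Context: Let $G$ be a simply connected simple compact Lie group with maximal torus $T$ and weight lattice $\Pi^*=\mathrm{Hom}(T,S^1)$. $\langle\cdot,\cdot\rangle$ is the unique Weyl-invariant inner product on $\Pi^*$ (extended to $\Pi^*\otimes\mathbb{R}$) with $\langle u,u\rangle=2$ for all long roots $u$ (in the simply laced case all roots are long). The fundamental Weyl chamber $V\subset\Pi^*\otimes\mathbb{R}$ is the set of points having non-negative inner product with all positive roots; $\theta$ is the highest root. The level $m$ fundamental alcove is $A=\{x\in V:\langle\theta,x\rangle\le m\}$. A level $m$ regular weight is an element of $\Pi^*$ in the interior of $A$. $N(G,m,p)$ denotes the number of level $m$ regular weights $a$ such that for every weight $w\in\Pi^*$ the denominator (in lowest terms) of the rational number $\langle w,a\rangle/m$ is a power $p^k$, $k\ge0$, of $p$. *)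

theory Defs
  imports "HOL-Analysis.Analysis" "HOL-Computational_Algebra.Primes"
begin

section \<open>Level m regular weights\<close>

text \<open>
  Below, \<open>P\<close> is a lattice of weights in a Euclidean space, \<open>R\<close> a root system, \<open>Rp\<close> a system of
  positive roots and \<open>W\<close> a set of maps representing the Weyl group.  The space
  \<open>P \<otimes> \<real>\<close> is realised as \<open>span P\<close>.  The forms \<open>B\<close> only matter on \<open>span P\<close>;
  the ambient inner product of the type is not used.
\<close>

definition positive_system :: "'a::euclidean_space set \<Rightarrow> 'a set \<Rightarrow> bool" where
  "positive_system R Rp \<longleftrightarrow>
    (\<exists>f::'a \<Rightarrow> real. linear f \<and> (\<forall>\<alpha>\<in>R. f \<alpha> \<noteq> 0) \<and> Rp = {\<alpha> \<in> R. f \<alpha> > 0})"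

definition highest_root :: "'a::euclidean_space set \<Rightarrow> 'a" where
  "highest_root Rp =
    (THE \<theta>. \<theta> \<in> Rp \<and>
      (\<forall>\<alpha>\<in>Rp. \<exists>c::'a \<Rightarrow> nat. \<theta> - \<alpha> = (\<Sum>\<beta>\<in>Rp. real (c \<beta>) *\<^sub>R \<beta>)))"

definition inner_product_on :: "'a::euclidean_space set \<Rightarrow> ('a \<Rightarrow> 'a \<Rightarrow> real) \<Rightarrow> bool" where
  "inner_product_on E B \<longleftrightarrow>
    (\<forall>x\<in>E. \<forall>y\<in>E. \<forall>z\<in>E. B (x + y) z = B x z + B y z) \<and>
    (\<forall>x\<in>E. \<forall>y\<in>E. \<forall>c. B (c *\<^sub>R x) y = c * B x y) \<and>
    (\<forall>x\<in>E. \<forall>y\<in>E. B x y = B y x) \<and>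
    (\<forall>x\<in>E. x \<noteq> 0 \<longrightarrow> B x x > 0)"

definition long_root :: "'a::euclidean_space set \<Rightarrow> ('a \<Rightarrow> 'a \<Rightarrow> real) \<Rightarrow> 'a \<Rightarrow> bool" where
  "long_root R B u \<longleftrightarrow> u \<in> R \<and> (\<forall>v\<in>R. B v v \<le> B u u)"

definition basic_inner_product ::
  "'a::euclidean_space set \<Rightarrow> 'a set \<Rightarrow> ('a \<Rightarrow> 'a) set \<Rightarrow> ('a \<Rightarrow> 'a \<Rightarrow> real) \<Rightarrow> bool" where
  "basic_inner_product P R W B \<longleftrightarrow>
    inner_product_on (span P) B \<and>
    (\<forall>w\<in>W. \<forall>x\<in>span P. \<forall>y\<in>span P. B (w x) (w y) = B x y) \<and>
    (\<forall>u. long_root R B u \<longrightarrow> B u u = 2)"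

definition weyl_chamber :: "'a::euclidean_space set \<Rightarrow> 'a set \<Rightarrow> ('a \<Rightarrow> 'a \<Rightarrow> real) \<Rightarrow> 'a set" where
  "weyl_chamber P Rp B = {x \<in> span P. \<forall>\<alpha>\<in>Rp. B \<alpha> x \<ge> 0}"

definition alcove ::
  "'a::euclidean_space set \<Rightarrow> 'a set \<Rightarrow> ('a \<Rightarrow> 'a \<Rightarrow> real) \<Rightarrow> nat \<Rightarrow> 'a set" where
  "alcove P Rp B m = {x \<in> weyl_chamber P Rp B. B (highest_root Rp) x \<le> real m}"

definition regular_weights ::
  "'a::euclidean_space set \<Rightarrow> 'a set \<Rightarrow> ('a \<Rightarrow> 'a \<Rightarrow> real) \<Rightarrow> nat \<Rightarrow> 'a set" where
  "regular_weights P Rp B m = P \<inter> (top_of_set (span P) interior_of alcove P Rp B m)"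

definition p_power_denominator :: "nat \<Rightarrow> real \<Rightarrow> bool" where
  "p_power_denominator p x \<longleftrightarrow>
    (\<exists>r::rat. x = of_rat r \<and> (\<exists>k. snd (quotient_of r) = int p ^ k))"

definition N ::
  "'a::euclidean_space set \<Rightarrow> 'a set \<Rightarrow> ('a \<Rightarrow> 'a \<Rightarrow> real) \<Rightarrow> nat \<Rightarrow> nat \<Rightarrow> nat" where
  "N P Rp B m p =
    card {a \<in> regular_weights P Rp B m. \<forall>w\<in>P. p_power_denominator p (B w a / real m)}"

section \<open>The special unitary group\<close>

text \<open>
  The index type \<open>'k\<close> gives the group \<open>SU(CARD('k))\<close>, of type \<open>A_n\<close> for \<open>CARD('k) = n + 1\<close>.
\<close>

definition adjoint_mat :: "complex^'k^'k \<Rightarrow> complex^'k^'k" where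
  "adjoint_mat U = (\<chi> i j. cnj (U $ j $ i))"

definition special_unitary :: "(complex^'k^'k) set" where
  "special_unitary = {U. adjoint_mat U ** U = mat 1 \<and> det U = 1}"

definition max_torus :: "(complex^'k^'k) set" where
  "max_torus = {U \<in> special_unitary. \<forall>i j. i \<noteq> j \<longrightarrow> U $ i $ j = 0}"

definition torus_normalizer :: "(complex^'k^'k) set" where
  "torus_normalizer =
    {g \<in> special_unitary. (\<lambda>s. g ** s ** adjoint_mat g) ` max_torus = max_torus}"

definition torus_characters :: "(complex^'k^'k \<Rightarrow> complex) set" where
  "torus_characters =
    {f. continuous_on max_torus f \<and> f ` max_torus \<subseteq> sphere 0 1 \<and>
        (\<forall>s\<in>max_torus. \<forall>t\<in>max_torus. f (s ** t) = f s * f t)}"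

text \<open>
  The point \<open>x\<close> of \<open>cartan\<close> stands for the element \<open>diag(2 \<pi> \<i> x)\<close> of the Lie algebra of
  the torus, so that the kernel of the exponential map consists of the integral points.
  The dual of \<open>cartan\<close> is identified with \<open>cartan\<close> by the standard inner product of
  \<open>real^'k\<close>.  This is the trace form, which is invariant under conjugation; therefore the
  (contragredient) Weyl group action on weights is the action on \<open>cartan\<close> itself.
\<close>

definition cartan :: "(real^'k) set" where
  "cartan = {x. (\<Sum>i\<in>UNIV. x $ i) = 0}"

definition diag_mat :: "real^'k \<Rightarrow> complex^'k^'k" where
  "diag_mat x = (\<chi> i j. if i = j then complex_of_real (x $ i) else 0)"

definition torus_exp :: "real^'k \<Rightarrow> complex^'k^'k" where
  "torus_exp x = (\<chi> i j. if i = j then cis (2 * pi * x $ i) else 0)"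

text \<open>A character is recorded by its differential, which determines it.\<close>

definition weight_lattice :: "(real^'k) set" where
  "weight_lattice =
    {\<mu> \<in> cartan. \<exists>f\<in>torus_characters. \<forall>x\<in>cartan. f (torus_exp x) = cis (2 * pi * (\<mu> \<bullet> x))}"

text \<open>The nonzero weights of the adjoint representation on the traceless complex matrices.\<close>

definition roots :: "(real^'k) set" where
  "roots =
    {\<alpha> \<in> cartan. \<alpha> \<noteq> 0 \<and>
      (\<exists>X::complex^'k^'k. X \<noteq> 0 \<and> trace X = 0 \<and>
        (\<forall>x\<in>cartan. diag_mat x ** X - X ** diag_mat x = (\<alpha> \<bullet> x) *\<^sub>R X))}"

definition weyl_group :: "(real^'k \<Rightarrow> real^'k) set" where
  "weyl_group =
    {w. \<exists>g\<in>torus_normalizer. \<forall>x\<in>cartan.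
        w x \<in> cartan \<and> diag_mat (w x) = g ** diag_mat x ** adjoint_mat g}"

end

theory Submission
  imports Defs
begin

text \<open>
  For \<open>SU(n + 1)\<close> the roots are the vectors \<open>e\<^sub>i - e\<^sub>j\<close>, the weights are the trace-zero vectors
  with integral coordinate differences, and the basic inner product is the standard one, because
  root reflections are induced by signed transposition matrices.  A positive system is a total
  order of the coordinates, so a regular weight of level \<open>m\<close> is determined by the integers
  \<open>m > a\<^sub>1 > \<dots> > a\<^sub>n > 0\<close>, where \<open>a\<^sub>j\<close> is the difference of its \<open>j\<close>-th largest and its smallest
  coordinate; its coordinates are \<open>a\<^sub>j - (a\<^sub>1 + \<dots> + a\<^sub>n) / (n + 1)\<close>, with \<open>a\<^sub>j = 0\<close> for the smallest.
  The denominator condition says that these coordinates divided by \<open>m\<close> lie in \<open>\<int>[1/p]\<close>.  Taking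
  differences gives \<open>a\<^sub>j = m' b\<^sub>j\<close>, and the smallest coordinate then gives \<open>n' dvd b\<^sub>1 + \<dots> + b\<^sub>n\<close>.
\<close>

section \<open>The torus, the roots and the weight lattice\<close>

text \<open>Common form of the torus elements and of \<open>diag_mat x\<close>, so that one
  conjugation formula serves both.\<close>

definition diagonal :: "('k \<Rightarrow> complex) \<Rightarrow> complex^'k^'k" where
  "diagonal d = (\<chi> i j. if i = j then d i else 0)"

lemma diagonal_nth: "diagonal d $ i $ j = (if i = j then d i else 0)"
  by (simp add: diagonal_def)

lemma diagonal_mult: "diagonal (c :: 'k::finite \<Rightarrow> complex) ** diagonal d = diagonal (\<lambda>i. c i * d i)"
  by (auto simp: diagonal_def matrix_matrix_mult_def vec_eq_iff if_distrib[of "\<lambda>x. x * _"] cong: if_cong)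

lemma det_diagonal_mat: "det (diagonal (d :: 'k::finite \<Rightarrow> complex)) = (\<Prod>i\<in>UNIV. d i)"
  by (subst det_diagonal) (auto simp: diagonal_nth)

lemma max_torus_iff:
  "(U :: complex^'k^'k::finite) \<in> max_torus \<longleftrightarrow>
     (\<exists>d. (\<forall>i. norm (d i) = 1) \<and> (\<Prod>i\<in>UNIV. d i) = 1 \<and> U = diagonal d)"
proof
  assume U: "U \<in> max_torus"
  define d where "d = (\<lambda>i. U $ i $ i)"
  have UD: "U = diagonal d"
    using U by (auto simp: max_torus_def vec_eq_iff diagonal_nth d_def)
  have adj: "adjoint_mat U = diagonal (\<lambda>i. cnj (d i))"
    by (auto simp: UD adjoint_mat_def vec_eq_iff diagonal_nth)
  have "adjoint_mat U ** U = mat 1" and det: "det U = 1"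
    using U by (auto simp: max_torus_def special_unitary_def)
  then have "diagonal (\<lambda>i. cnj (d i) * d i) = (mat 1 :: complex^'k^'k)"
    by (simp add: adj diagonal_mult flip: UD) (simp add: UD diagonal_mult)
  then have "cnj (d i) * d i = 1" for i
    by (simp add: vec_eq_iff diagonal_nth mat_def) metis
  then have "norm (d i) = 1" for i
    by (metis complex_mod_cnj norm_mult norm_one abs_square_eq_1 power2_eq_square abs_norm_cancel)
  moreover have "(\<Prod>i\<in>UNIV. d i) = 1"
    using det by (simp add: UD det_diagonal_mat)
  ultimately show "\<exists>d. (\<forall>i. norm (d i) = 1) \<and> (\<Prod>i\<in>UNIV. d i) = 1 \<and> U = diagonal d"
    using UD by blast
next
  assume "\<exists>d. (\<forall>i. norm (d i) = 1) \<and> (\<Prod>i\<in>UNIV. d i) = 1 \<and> U = diagonal d"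
  then obtain d where d: "\<And>i. norm (d i) = 1" "(\<Prod>i\<in>UNIV. d i) = 1" and UD: "U = diagonal d"
    by blast
  have adj: "adjoint_mat (diagonal d) = diagonal (\<lambda>i. cnj (d i))"
    by (auto simp: adjoint_mat_def vec_eq_iff diagonal_nth)
  have "cnj (d i) * d i = 1" for i
    using d(1)[of i] by (metis complex_norm_square mult.commute of_real_1 power_one)
  then show "U \<in> max_torus"
    using d(2)
    by (auto simp: max_torus_def special_unitary_def adj UD diagonal_mult det_diagonal_mat
        diagonal_nth vec_eq_iff mat_def)
qed

section \<open>Roots as differences of coordinate vectors\<close>

abbreviation root_vec :: "'k \<Rightarrow> 'k \<Rightarrow> real^'k" where
  "root_vec i j \<equiv> axis i 1 - axis j 1"

lemma root_vec_cartan: "root_vec i j \<in> (cartan :: (real^'k::finite) set)"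
  by (simp add: cartan_def axis_def sum_subtractf)

lemma inner_root_vec: "x \<bullet> root_vec i j = x $ i - x $ j" for x :: "real^'k::finite"
  by (simp add: inner_diff_right inner_axis)

lemma inner_root_vec': "root_vec i j \<bullet> x = x $ i - x $ j" for x :: "real^'k::finite"
  by (simp add: inner_commute inner_root_vec)

text \<open>The entry of \<open>[diag_mat x, X]\<close> at \<open>(a, b)\<close> is
  \<open>x $ a - x $ b\<close> times that of \<open>X\<close>, so one nonzero entry of
  \<open>X\<close> determines \<alpha>. Conversely, each elementary off-diagonal matrix is a root
  vector.\<close>

lemma roots_eq: "roots = {root_vec i j |i j. i \<noteq> (j :: 'k::finite)}"
proof (intro set_eqI iffI)
  fix \<alpha> :: "real^'k" assume "\<alpha> \<in> roots"
  then obtain X :: "complex^'k^'k" where \<alpha>: "\<alpha> \<in> cartan" "\<alpha> \<noteq> 0" and "X \<noteq> 0"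
    and X: "\<And>x. x \<in> cartan \<Longrightarrow> diag_mat x ** X - X ** diag_mat x = (\<alpha> \<bullet> x) *\<^sub>R X"
    by (auto simp: roots_def)
  then obtain a b where ab: "X $ a $ b \<noteq> 0"
    by (auto simp: vec_eq_iff)
  have "\<alpha> \<bullet> x = x $ a - x $ b" if "x \<in> cartan" for x
  proof -
    have "(diag_mat x ** X - X ** diag_mat x) $ a $ b = of_real (x $ a - x $ b) * X $ a $ b"
      by (simp add: diag_mat_def matrix_matrix_mult_def if_distrib[of "\<lambda>x. x * _"]
          if_distrib[of "\<lambda>x. _ * x"] algebra_simps cong: if_cong)
    with X[OF that] have "of_real (\<alpha> \<bullet> x) * X $ a $ b = of_real (x $ a - x $ b) * X $ a $ b"
      by (simp add: scaleR_conv_of_real[symmetric])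
    with ab show ?thesis
      by (metis mult_cancel_right of_real_eq_iff)
  qed
  then have *: "(\<alpha> - root_vec a b) \<bullet> x = 0" if "x \<in> cartan" for x
    using that by (simp add: inner_diff_left[of \<alpha>] inner_root_vec')
  \<comment> \<open>The difference lies in \<open>cartan\<close> and is orthogonal to
    \<open>cartan\<close>, hence to itself.\<close>
  have "\<alpha> - root_vec a b \<in> cartan"
    using \<alpha>(1) root_vec_cartan[of a b] by (simp add: cartan_def sum_subtractf)
  with * have "\<alpha> = root_vec a b"
    by (metis inner_eq_zero_iff right_minus_eq)
  with \<alpha>(2) show "\<alpha> \<in> {root_vec i j |i j. i \<noteq> j}" by auto
next
  fix \<alpha> :: "real^'k" assume "\<alpha> \<in> {root_vec i j |i j. i \<noteq> j}"
  then obtain a b where \<alpha>: "\<alpha> = root_vec a b" and ab: "a \<noteq> b" by blast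
  define X :: "complex^'k^'k" where "X = (\<chi> i j. if i = a \<and> j = b then 1 else 0)"
  have "X $ a $ b = 1" by (simp add: X_def)
  then have "X \<noteq> 0" by auto
  moreover have "trace X = 0"
    using ab by (auto simp: trace_def X_def intro!: sum.neutral)
  moreover have "diag_mat x ** X - X ** diag_mat x = (\<alpha> \<bullet> x) *\<^sub>R X" for x
    by (auto simp: \<alpha> inner_root_vec' diag_mat_def matrix_matrix_mult_def X_def vec_eq_iff
        if_distrib[of "\<lambda>x. x * _"] if_distrib[of "\<lambda>x. _ * x"] scaleR_conv_of_real[where 'a=complex] cong: if_cong)
  moreover have "\<alpha> $ a = 1" using ab by (simp add: \<alpha> axis_def)
  then have "\<alpha> \<noteq> 0" by auto
  ultimately show "\<alpha> \<in> roots"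
    using root_vec_cartan[of a b] unfolding roots_def \<alpha> by blast
qed

section \<open>Characters of the torus and integrality\<close>

lemma cis_2pi_eq_1_iff: "cis (2 * pi * x) = 1 \<longleftrightarrow> x \<in> \<int>"
proof
  assume "cis (2 * pi * x) = 1"
  then have "cos (2 * pi * x) = 1" by (metis cis.sel(1) one_complex.sel(1))
  then obtain n :: int where "2 * pi * x = of_int n * 2 * pi"
    using cos_one_2pi_int by blast
  then have "x = of_int n" by (simp add: field_simps)
  then show "x \<in> \<int>" by simp
qed simp

text \<open>Root vectors lie in the kernel of \<open>torus_exp\<close>, so a character forces
  integral pairings with them. Conversely, a monomial in the diagonal entries realises
  \<mu>.\<close>

lemma weight_lattice_eq:
  "weight_lattice = {\<mu> \<in> cartan. \<forall>i j :: 'k::finite. \<mu> $ i - \<mu> $ j \<in> \<int>}"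
proof (intro set_eqI iffI)
  fix \<mu> :: "real^'k" assume "\<mu> \<in> weight_lattice"
  then obtain f :: "complex^'k^'k \<Rightarrow> complex" where \<mu>: "\<mu> \<in> cartan"
    and f: "\<And>x. x \<in> cartan \<Longrightarrow> f (torus_exp x) = cis (2 * pi * (\<mu> \<bullet> x))"
    by (auto simp: weight_lattice_def)
  have "\<mu> $ i - \<mu> $ j \<in> \<int>" for i j
  proof -
    have "torus_exp (root_vec i j) = torus_exp (0 :: real^'k)"
      by (auto simp: torus_exp_def vec_eq_iff axis_def cis_2pi_eq_1_iff)
    then have "cis (2 * pi * (\<mu> \<bullet> root_vec i j)) = cis (2 * pi * (\<mu> \<bullet> 0))"
      by (metis f root_vec_cartan diff_self)
    then show ?thesis
      by (simp add: inner_root_vec cis_2pi_eq_1_iff)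
  qed
  with \<mu> show "\<mu> \<in> {\<mu> \<in> cartan. \<forall>i j :: 'k. \<mu> $ i - \<mu> $ j \<in> \<int>}" by blast
next
  fix \<mu> :: "real^'k" assume "\<mu> \<in> {\<mu> \<in> cartan. \<forall>i j :: 'k. \<mu> $ i - \<mu> $ j \<in> \<int>}"
  then have \<mu>: "\<mu> \<in> cartan" and int: "\<And>i j. \<mu> $ i - \<mu> $ j \<in> \<int>" by auto
  fix k :: 'k
  \<comment> \<open>The coordinates of \<mu> need not be integers, but they become so after
    subtracting one of them. This constant shift is invisible on trace-zero vectors, so these
    exponents have differential \<mu>.\<close>
  define c where "c = (\<lambda>i. \<lfloor>\<mu> $ i - \<mu> $ k\<rfloor>)"
  have c: "of_int (c i) = \<mu> $ i - \<mu> $ k" for i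
    using int[of i k] by (metis c_def Ints_cases floor_of_int)
  define f where "f = (\<lambda>U :: complex^'k^'k. \<Prod>i\<in>UNIV. (U $ i $ i) powi c i)"
  have nz: "U $ i $ i \<noteq> 0" if "U \<in> max_torus" for U :: "complex^'k^'k" and i
    using that by (auto simp: max_torus_iff diagonal_nth) (metis norm_zero zero_neq_one)
  have "f \<in> torus_characters"
    unfolding torus_characters_def
  proof (intro CollectI conjI ballI)
    show "continuous_on max_torus f"
      unfolding f_def using nz by (intro continuous_intros) auto
    show "f ` max_torus \<subseteq> sphere 0 1"
      by (auto simp: f_def max_torus_iff diagonal_nth prod_norm[symmetric] norm_power_int)
    show "f (s ** t) = f s * f t" if "s \<in> max_torus" "t \<in> max_torus" for s t
      using that
      by (auto simp: f_def max_torus_iff diagonal_mult diagonal_nth power_int_mult_distrib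
          simp flip: prod.distrib)
  qed
  moreover have "f (torus_exp x) = cis (2 * pi * (\<mu> \<bullet> x))" if "x \<in> cartan" for x
  proof -
    have "f (torus_exp x) = (\<Prod>i\<in>UNIV. cis (of_int (c i) * (2 * pi * x $ i)))"
      by (simp add: f_def torus_exp_def cis_power_int)
    also have "\<dots> = cis (\<Sum>i\<in>UNIV. of_int (c i) * (2 * pi * x $ i))"
      by (simp add: cis_conv_exp exp_sum sum_distrib_left)
    also have "(\<Sum>i\<in>UNIV. of_int (c i) * (2 * pi * x $ i)) =
       2 * pi * ((\<Sum>i\<in>UNIV. \<mu> $ i * x $ i) - \<mu> $ k * (\<Sum>i\<in>UNIV. x $ i))"
      by (simp add: c sum_distrib_left algebra_simps sum_subtractf)
    also have "\<dots> = 2 * pi * (\<mu> \<bullet> x)"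
      using that by (simp add: inner_vec_def cartan_def)
    finally show ?thesis .
  qed
  ultimately show "\<mu> \<in> weight_lattice"
    using \<mu> unfolding weight_lattice_def by blast
qed

section \<open>The Weyl group and the basic inner product\<close>

lemma cartan_subspace: "subspace cartan"
  by (auto simp: cartan_def subspace_def sum.distrib simp flip: sum_distrib_left)

lemma diag_mat_eq: "diag_mat x = diagonal (\<lambda>i. complex_of_real (x $ i))"
  by (simp add: diag_mat_def diagonal_def)

text \<open>The reflection exchanges the coordinates \<open>a\<close> and \<open>b\<close>. A
  transposition matrix induces it but has determinant -1; negating row \<open>b\<close> gives
  determinant 1, and the signs cancel in the conjugation of diagonal matrices.\<close>

lemma root_reflection_in_weyl_group:
  assumes ab: "a \<noteq> (b :: 'k::finite)"
  shows "(\<lambda>x. x - (x \<bullet> root_vec a b) *\<^sub>R root_vec a b) \<in> weyl_group"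
proof -
  define t where "t = Transposition.transpose a b"
  have tt [simp]: "t (t i) = i" for i by (simp add: t_def)
  have t_eq: "t i = j \<longleftrightarrow> i = t j" for i j using tt by metis
  have bij: "bij_betw t UNIV UNIV" by (simp add: t_def)
  define e :: "'k \<Rightarrow> complex" where "e = (\<lambda>i. if i = b then -1 else 1)"
  have e [simp]: "e i * e i = 1" "cnj (e i) = e i" for i by (auto simp: e_def)
  define g :: "complex^'k^'k" where "g = (\<chi> i k. if k = t i then e i else 0)"
  have adj: "adjoint_mat g ** g = mat 1"
    by (auto simp: adjoint_mat_def g_def matrix_matrix_mult_def mat_def vec_eq_iff
        if_distrib[of "\<lambda>x. x * _"] if_distrib[of "\<lambda>x. cnj x"] t_eq[symmetric] eq_commute[of _ "t _"] cong: if_cong)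
  have "det g = det (\<chi> i. if i = b then (-1) *s mat 1 $ t i else (mat 1 :: complex^'k^'k) $ t i)"
    by (rule arg_cong[of _ _ det]) (auto simp: g_def e_def vec_eq_iff mat_def)
  also have "\<dots> = - det (\<chi> i. (mat 1 :: complex^'k^'k) $ t i)"
    by (subst det_row_mul) (auto intro!: arg_cong[of _ _ det] simp: vec_eq_iff)
  also have "\<dots> = 1"
    using ab by (subst det_permute_rows) (auto simp: t_def permutes_swap_id sign_swap_id)
  finally have g: "g \<in> special_unitary"
    using adj by (simp add: special_unitary_def)
  have conj: "g ** diagonal d ** adjoint_mat g = diagonal (\<lambda>i. d (t i))" for d
    by (auto simp: adjoint_mat_def g_def matrix_matrix_mult_def diagonal_nth vec_eq_iff
        if_distrib[of "\<lambda>x. x * _"] if_distrib[of "\<lambda>x. _ * x"] if_distrib[of "\<lambda>x. cnj x"]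
        mult.commute mult.left_commute dest: arg_cong[of _ _ t] cong: if_cong)
  have torus: "diagonal (\<lambda>i. d (t i)) \<in> max_torus" if "diagonal d \<in> max_torus" for d
  proof -
    \<comment> \<open>\<open>max_torus_iff\<close> yields only some entries with the same diagonal
      matrix; injectivity of \<open>diagonal\<close> identifies them with \<open>d\<close>.\<close>
    have "d' = d" if "diagonal d = (diagonal d' :: complex^'k^'k)" for d'
      using that by (simp add: vec_eq_iff diagonal_nth fun_eq_iff) metis
    with that have "\<And>i. norm (d i) = 1" "(\<Prod>i\<in>UNIV. d i) = 1"
      by (auto simp: max_torus_iff)
    then show ?thesis
      using prod.reindex_bij_betw[OF bij, of d]
      by (auto simp: max_torus_iff intro!: exI[of _ "\<lambda>i. d (t i)"])
  qed
  have "(\<lambda>s. g ** s ** adjoint_mat g) ` max_torus = max_torus"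
  proof (intro equalityI subsetI)
    fix U assume "U \<in> (\<lambda>s. g ** s ** adjoint_mat g) ` max_torus"
    then obtain V where V: "V \<in> max_torus" "U = g ** V ** adjoint_mat g" by blast
    then obtain d where "V = diagonal d" by (auto simp: max_torus_iff)
    with V torus[of d] show "U \<in> max_torus" by (simp add: conj)
  next
    fix U :: "complex^'k^'k" assume U: "U \<in> max_torus"
    then obtain d where d: "U = diagonal d" by (auto simp: max_torus_iff)
    \<comment> \<open>Since \<open>t\<close> is an involution, permuting the entries of
      \<open>U\<close> gives a preimage.\<close>
    then have "U = g ** diagonal (\<lambda>i. d (t i)) ** adjoint_mat g" by (simp add: conj)
    with torus U d show "U \<in> (\<lambda>s. g ** s ** adjoint_mat g) ` max_torus" by blast
  qed
  with g have "g \<in> torus_normalizer" by (simp add: torus_normalizer_def)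
  moreover have "x - (x \<bullet> root_vec a b) *\<^sub>R root_vec a b \<in> cartan" if "x \<in> cartan" for x :: "real^'k"
    using that root_vec_cartan cartan_subspace by (metis subspace_diff subspace_scale)
  moreover have "diag_mat (x - (x \<bullet> root_vec a b) *\<^sub>R root_vec a b) =
      g ** diag_mat x ** adjoint_mat g" for x
    using ab unfolding diag_mat_eq conj inner_root_vec
    by (auto simp: vec_eq_iff diagonal_nth t_def axis_def
        Transposition.transpose_def)
  ultimately show ?thesis unfolding weyl_group_def by blast
qed

text \<open>For a trace-zero \<open>x\<close>, subtracting \<open>x $ i\<close> times a fixed
  coordinate vector for every \<open>i\<close> changes nothing in total, and turns the basis
  expansion into a combination of roots.\<close>

lemma cartan_subset_span_roots: "(cartan :: (real^'k::finite) set) \<subseteq> span roots"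
proof
  fix x :: "real^'k" assume x: "x \<in> cartan"
  fix k :: 'k
  have "x = (\<Sum>i\<in>UNIV. x $ i *\<^sub>R axis i 1) - (\<Sum>i\<in>UNIV. x $ i) *\<^sub>R axis k 1"
    using x basis_expansion[of x] by (simp add: cartan_def scalar_mult_eq_scaleR)
  also have "\<dots> = (\<Sum>i\<in>UNIV. x $ i *\<^sub>R root_vec i k)"
    by (simp add: scaleR_diff_right sum_subtractf scaleR_sum_left)
  also have "\<dots> \<in> span roots"
  proof (intro span_sum span_scale)
    show "root_vec i k \<in> span roots" for i
      by (cases "i = k") (auto simp: roots_eq span_zero intro!: span_base)
  qed
  finally show "x \<in> span roots" .
qed

lemma span_weight_lattice: "span weight_lattice = (cartan :: (real^'k::finite) set)"
proof (rule antisym)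
  show "span weight_lattice \<subseteq> (cartan :: (real^'k::finite) set)"
    by (rule span_minimal[OF _ cartan_subspace]) (auto simp: weight_lattice_eq)
  have "roots \<subseteq> (weight_lattice :: (real^'k::finite) set)"
    using root_vec_cartan by (auto simp: roots_eq weight_lattice_eq axis_def)
  then show "cartan \<subseteq> span (weight_lattice :: (real^'k::finite) set)"
    using cartan_subset_span_roots span_mono by blast
qed

text \<open>Invariance under root reflections fixes the pairing of any vector with a root up to the
  length of that root. All roots turn out to have equal length, so all are long and have square
  length 2; the roots span the space.\<close>

lemma basic_inner_product_eq_inner:
  fixes B :: "real^'k::finite \<Rightarrow> real^'k \<Rightarrow> real"
  assumes B: "basic_inner_product weight_lattice roots weyl_group B"
    and xy: "x \<in> cartan" "y \<in> cartan"
  shows "B x y = x \<bullet> y"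
proof -
  have add: "B (x + y) z = B x z + B y z" if "x \<in> cartan" "y \<in> cartan" "z \<in> cartan" for x y z
    using B that by (auto simp: basic_inner_product_def inner_product_on_def span_weight_lattice)
  have scale: "B (c *\<^sub>R x) y = c * B x y" if "x \<in> cartan" "y \<in> cartan" for x y c
    using B that by (auto simp: basic_inner_product_def inner_product_on_def span_weight_lattice)
  have sym: "B x y = B y x" if "x \<in> cartan" "y \<in> cartan" for x y
    using B that by (auto simp: basic_inner_product_def inner_product_on_def span_weight_lattice)
  have add': "B z (x + y) = B z x + B z y" if "x \<in> cartan" "y \<in> cartan" "z \<in> cartan" for x y z
    using add[OF that] sym that subspace_add[OF cartan_subspace] by metis
  have scale': "B y (c *\<^sub>R x) = c * B y x" if "x \<in> cartan" "y \<in> cartan" for x y c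
    using scale[OF that] sym that subspace_scale[OF cartan_subspace] by metis
  have inv: "B (w x) (w y) = B x y" if "w \<in> weyl_group" "x \<in> cartan" "y \<in> cartan" for w x y
    using B that by (auto simp: basic_inner_product_def span_weight_lattice)
  have long: "B u u = 2" if "long_root roots B u" for u
    using B that by (auto simp: basic_inner_product_def)
  \<comment> \<open>The reflection sends the root \<open>r\<close> to \<open>- r\<close> and
    \<open>x\<close> to \<open>x - (x \<bullet> r) *\<^sub>R r\<close>; the formula is invariance of
    \<open>B x r\<close> solved for \<open>B x r\<close>.\<close>
  have refl: "2 * B x (root_vec a b) = (x \<bullet> root_vec a b) * B (root_vec a b) (root_vec a b)"
    if "x \<in> cartan" "a \<noteq> b" for x a b
  proof -
    let ?r = "root_vec a b :: real^'k"
    have [simp]: "?r \<in> cartan" by (rule root_vec_cartan)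
    have "?r \<bullet> ?r = 2" using that(2) by (simp add: inner_diff_left inner_diff_right inner_axis_axis)
    then have *: "?r - (?r \<bullet> ?r) *\<^sub>R ?r = (-1) *\<^sub>R ?r" by (simp only: scaleR_2) simp
    let ?c = "x \<bullet> ?r"
    have "B x ?r = B (x - ?c *\<^sub>R ?r) ((-1) *\<^sub>R ?r)"
      using inv[OF root_reflection_in_weyl_group[OF that(2)] that(1), of ?r]
      unfolding * by simp
    also have "\<dots> = - B (x + (- ?c) *\<^sub>R ?r) ?r"
      using scale'[of ?r _ "-1"] that(1) by (simp add: subspace_diff subspace_scale cartan_subspace)
    also have "\<dots> = - B x ?r + ?c * B ?r ?r"
      using that(1) by (subst add) (simp_all add: scale subspace_neg subspace_scale cartan_subspace del: scaleR_minus_left)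
    finally show ?thesis by simp
  qed
  define q where "q a b = B (root_vec a b) (root_vec a b)" for a b
  have q_sym: "q a b = q b a" for a b
  proof -
    have "(-1) *\<^sub>R root_vec a b = (root_vec b a :: real^'k)" by simp
    then show ?thesis
      using scale[of "root_vec a b" "root_vec b a" "-1"] scale'[of "root_vec a b" "root_vec a b" "-1"]
      by (simp add: q_def root_vec_cartan)
  qed
  \<comment> \<open>Distinct roots sharing their first index have standard inner product 1, so
    \<open>refl\<close> computes their symmetric pairing once from each length.\<close>
  have q_right: "q a b = q a c" if "a \<noteq> b" "a \<noteq> c" for a b c
  proof (cases "b = c")
    case False
    then show ?thesis
      using refl[of "root_vec a b" a c] refl[of "root_vec a c" a b] that
        sym[of "root_vec a b" "root_vec a c"]
      by (simp add: q_def root_vec_cartan inner_diff_left inner_diff_right inner_axis_axis)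
  qed auto
  have q_const: "q a b = q c d" if "a \<noteq> b" "c \<noteq> d" for a b c d
  proof (cases "d = a")
    case True
    then show ?thesis using q_right[of a b c] q_sym[of a c] that by simp
  next
    case False
    \<comment> \<open>The chain runs through the pairs \<open>(a, b)\<close>, \<open>(a, d)\<close>,
      \<open>(d, a)\<close>, \<open>(d, c)\<close>, \<open>(c, d)\<close>.\<close>
    then show ?thesis using q_right[of a b d] q_sym[of a d] q_right[of d a c] q_sym[of d c] that by simp
  qed
  have q2: "q a b = 2" if "a \<noteq> b" for a b
    unfolding q_def
  proof (rule long)
    show "long_root roots B (root_vec a b)"
      unfolding long_root_def
    proof (intro conjI ballI)
      fix v :: "real^'k" assume "v \<in> roots"
      then obtain i j where "v = root_vec i j" "i \<noteq> j" by (auto simp: roots_eq)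
      with q_const[of i j a b] that show "B v v \<le> B (root_vec a b) (root_vec a b)"
        by (simp add: q_def)
    qed (use that in \<open>auto simp: roots_eq\<close>)
  qed
  have "span roots \<subseteq> {z \<in> cartan. B x z = x \<bullet> z}"
  proof (rule span_minimal)
    show "roots \<subseteq> {z \<in> cartan. B x z = x \<bullet> z}"
      using refl[OF xy(1)] q2 by (auto simp: roots_eq root_vec_cartan q_def)
    show "subspace {z \<in> cartan. B x z = x \<bullet> z}"
      using xy(1) cartan_subspace scale'[of x x 0]
      by (auto simp: subspace_def add' scale' inner_add_right)
  qed
  then show ?thesis using xy cartan_subset_span_roots by blast
qed

section \<open>Positive roots and the alcove\<close>

text \<open>The functional takes distinct values on the coordinate vectors because it vanishes on no
  root. Ranking the coordinates by decreasing value turns positivity into an order of ranks.\<close>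

lemma positive_system_rank:
  fixes Rp :: "(real^'k::finite) set"
  assumes "positive_system roots Rp"
  obtains r :: "'k \<Rightarrow> nat" where "bij_betw r UNIV {..<CARD('k)}"
    and "Rp = {root_vec i j |i j. r i < r j}"
proof -
  obtain f :: "real^'k \<Rightarrow> real" where f: "linear f" "\<And>\<alpha>. \<alpha> \<in> roots \<Longrightarrow> f \<alpha> \<noteq> 0"
    and Rp: "Rp = {\<alpha> \<in> roots. f \<alpha> > 0}"
    using assms by (auto simp: positive_system_def)
  define h where "h i = f (axis i 1)" for i
  have fh: "f (root_vec i j) = h i - h j" for i j
    using f(1) by (simp add: h_def linear_diff)
  have "h i \<noteq> h j" if "i \<noteq> j" for i j
    using f(2)[of "root_vec i j"] that by (auto simp: roots_eq fh)
  then have inj: "i = j" if "h i = h j" for i j using that by blast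
  \<comment> \<open>Counting the larger values gives rank 0 to the coordinate with the largest
    value.\<close>
  define r where "r i = card {j. h j > h i}" for i
  have mono: "r i < r j" if "h i > h j" for i j
    unfolding r_def using that by (intro psubset_card_mono) auto
  have r_iff: "r i < r j \<longleftrightarrow> h i > h j" for i j
    using mono[of i j] mono[of j i] inj[of i j] by fastforce
  have "inj r"
    using r_iff inj by (metis injI less_irrefl linorder_neqE_linordered_idom)
  moreover have "r i < CARD('k)" for i
    unfolding r_def by (intro psubset_card_mono) auto
  then have "range r \<subseteq> {..<CARD('k)}" by auto
  ultimately have "bij_betw r UNIV {..<CARD('k)}"
    by (metis bij_betw_def card_image card_lessThan card_subset_eq finite_lessThan)
  moreover have "Rp = {root_vec i j |i j. i \<noteq> j \<and> 0 < f (root_vec i j)}"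
    unfolding Rp roots_eq by blast
  moreover have "i \<noteq> j \<and> 0 < f (root_vec i j) \<longleftrightarrow> r i < r j" for i j
    unfolding fh r_iff by auto
  ultimately show ?thesis using that by simp
qed

text \<open>Subtracting \<open>root_vec i j\<close> from \<open>root_vec a z\<close> leaves
  \<open>root_vec a i + root_vec j z\<close>, and each summand is a positive root or 0. Uniqueness
  is antisymmetry of domination.\<close>

lemma highest_root_eq:
  fixes r :: "'k::finite \<Rightarrow> nat"
  assumes Rp: "Rp = {root_vec i j |i j. r i < r j}" and "inj r"
    and r: "\<And>i. r a \<le> r i" "\<And>i. r i \<le> r z" "r a < r z"
  shows "highest_root Rp = root_vec a z"
proof -
  let ?dom = "\<lambda>\<theta> \<alpha>. \<exists>c :: real^'k \<Rightarrow> nat. \<theta> - \<alpha> = (\<Sum>\<beta>\<in>Rp. real (c \<beta>) *\<^sub>R \<beta>)"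
  \<comment> \<open>a functional positive on \<open>Rp\<close>; it forces the coefficients of two mutually dominating roots to vanish\<close>
  define \<phi> :: "real^'k \<Rightarrow> real" where "\<phi> x = x \<bullet> (\<chi> i. - real (r i))" for x
  have \<phi>_pos: "\<phi> \<beta> > 0" if "\<beta> \<in> Rp" for \<beta>
    using that by (auto simp: Rp \<phi>_def inner_root_vec')
  have "finite (range (\<lambda>(i, j). root_vec i j :: real^'k))" by simp
  then have fin: "finite Rp" by (rule rev_finite_subset) (auto simp: Rp)
  have \<phi>_sum: "\<phi> (\<Sum>\<beta>\<in>Rp. real (c \<beta>) *\<^sub>R \<beta>) = (\<Sum>\<beta>\<in>Rp. real (c \<beta>) * \<phi> \<beta>)" for c
    by (simp add: \<phi>_def inner_sum_left)
  \<comment> \<open>The case \<open>v = 0\<close> covers summands that degenerate when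
    \<open>i = a\<close> or \<open>j = z\<close>.\<close>
  have single: "(\<Sum>\<beta>\<in>Rp. real (of_bool (\<beta> = v)) *\<^sub>R \<beta>) = v" if "v \<in> Rp \<or> v = 0" for v
    using that fin by (auto simp: of_bool_def if_distrib if_distribR cong: if_cong)
  have root_or_0: "root_vec i j \<in> Rp \<or> root_vec i j = 0" if "r i \<le> r j" for i j
    using that \<open>inj r\<close> unfolding Rp by (metis (mono_tags, lifting) diff_self injD le_neq_implies_less mem_Collect_eq)
  have dom: "?dom (root_vec a z) \<alpha>" if "\<alpha> \<in> Rp" for \<alpha>
  proof -
    obtain i j where \<alpha>: "\<alpha> = root_vec i j" using \<open>\<alpha> \<in> Rp\<close> by (auto simp: Rp)
    let ?c = "\<lambda>\<beta> :: real^'k. of_bool (\<beta> = root_vec a i) + of_bool (\<beta> = root_vec j z) :: nat"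
    have "(\<Sum>\<beta>\<in>Rp. real (?c \<beta>) *\<^sub>R \<beta>) = root_vec a i + root_vec j z"
      using single[OF root_or_0[OF r(1)[of i]]] single[OF root_or_0[OF r(2)[of j]]]
      by (simp add: scaleR_add_left sum.distrib)
    then have "root_vec a z - \<alpha> = (\<Sum>\<beta>\<in>Rp. real (?c \<beta>) *\<^sub>R \<beta>)" by (simp add: \<alpha>)
    then show ?thesis by (rule exI[of _ ?c])
  qed
  have in_Rp: "root_vec a z \<in> Rp" using r(3) by (auto simp: Rp)
  show ?thesis
    unfolding highest_root_def
  proof (rule the_equality)
    show "root_vec a z \<in> Rp \<and> (\<forall>\<alpha>\<in>Rp. ?dom (root_vec a z) \<alpha>)"
      using in_Rp dom by blast
  next
    fix \<theta> assume \<theta>: "\<theta> \<in> Rp \<and> (\<forall>\<alpha>\<in>Rp. ?dom \<theta> \<alpha>)"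
    then obtain c :: "real^'k \<Rightarrow> nat" where c: "\<theta> - root_vec a z = (\<Sum>\<beta>\<in>Rp. real (c \<beta>) *\<^sub>R \<beta>)"
      using in_Rp by blast
    obtain d :: "real^'k \<Rightarrow> nat" where d: "root_vec a z - \<theta> = (\<Sum>\<beta>\<in>Rp. real (d \<beta>) *\<^sub>R \<beta>)"
      using dom \<theta> by blast
    have "(\<Sum>\<beta>\<in>Rp. real (c \<beta>) * \<phi> \<beta>) = \<phi> \<theta> - \<phi> (root_vec a z)"
      by (simp add: c[symmetric] \<phi>_sum[symmetric]) (simp add: \<phi>_def inner_diff_left)
    moreover have "(\<Sum>\<beta>\<in>Rp. real (d \<beta>) * \<phi> \<beta>) = \<phi> (root_vec a z) - \<phi> \<theta>"
      by (simp add: d[symmetric] \<phi>_sum[symmetric]) (simp add: \<phi>_def inner_diff_left)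
    moreover have "(\<Sum>\<beta>\<in>Rp. real (c \<beta>) * \<phi> \<beta>) \<ge> 0" "(\<Sum>\<beta>\<in>Rp. real (d \<beta>) * \<phi> \<beta>) \<ge> 0"
      using \<phi>_pos by (auto intro!: sum_nonneg simp: less_imp_le)
    \<comment> \<open>The two sums are nonnegative and negatives of each other.\<close>
    ultimately have "(\<Sum>\<beta>\<in>Rp. real (c \<beta>) * \<phi> \<beta>) = 0" by linarith
    then have "\<forall>\<beta>\<in>Rp. real (c \<beta>) * \<phi> \<beta> = 0"
      using fin \<phi>_pos by (subst (asm) sum_nonneg_eq_0_iff) (auto simp: less_imp_le)
    then have "\<forall>\<beta>\<in>Rp. c \<beta> = 0" using \<phi>_pos by fastforce
    then show "\<theta> = root_vec a z" using c by simp
  qed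
qed

text \<open>Strict inequalities cut out a relatively open subset of the alcove. An interior point
  satisfies them, since it can be moved a little in any direction of \<open>cartan\<close> without
  leaving the alcove.\<close>

lemma regular_weights_eq:
  fixes r :: "'k::finite \<Rightarrow> nat"
  assumes Rp: "Rp = {root_vec i j |i j. r i < r j}" and "inj r"
    and r: "\<And>i. r a \<le> r i" "\<And>i. r i \<le> r z" "r a < r z"
    and B: "\<And>x y. x \<in> cartan \<Longrightarrow> y \<in> cartan \<Longrightarrow> B x y = x \<bullet> y"
  shows "regular_weights weight_lattice Rp B m =
    {\<mu> \<in> weight_lattice. (\<forall>i j. r i < r j \<longrightarrow> \<mu> $ i > \<mu> $ j) \<and> \<mu> $ a - \<mu> $ z < real m}"
proof -
  let ?A = "alcove weight_lattice Rp B m"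
  define I where "I = {x \<in> cartan. (\<forall>i j. r i < r j \<longrightarrow> x $ i > x $ j) \<and> x $ a - x $ z < real m}"
  have B_root: "B (root_vec i j) x = x $ i - x $ j" if "x \<in> cartan" for i j x
    using B[OF root_vec_cartan that] by (simp add: inner_root_vec')
  have Ball_Rp: "(\<forall>\<alpha>\<in>Rp. Q \<alpha>) \<longleftrightarrow> (\<forall>i j. r i < r j \<longrightarrow> Q (root_vec i j))" for Q
    unfolding Rp by blast
  have A: "?A = {x \<in> cartan. (\<forall>i j. r i < r j \<longrightarrow> x $ i \<ge> x $ j) \<and> x $ a - x $ z \<le> real m}"
    unfolding alcove_def weyl_chamber_def highest_root_eq[OF assms(1-5)] span_weight_lattice Ball_Rp
    by (auto simp: B_root)
  have "top_of_set cartan interior_of ?A = I"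
  proof (rule interior_of_unique)
    show "I \<subseteq> ?A" by (auto simp: A I_def less_imp_le)
    have "open ((\<Inter>i. \<Inter>j. {x :: real^'k. r i < r j \<longrightarrow> x $ i > x $ j}) \<inter> {x. x $ a - x $ z < real m})"
      by (intro open_Int open_INT ballI open_Collect_imp open_Collect_less continuous_intros) auto
    moreover have "I = cartan \<inter> ((\<Inter>i. \<Inter>j. {x. r i < r j \<longrightarrow> x $ i > x $ j}) \<inter> {x. x $ a - x $ z < real m})"
      by (auto simp: I_def)
    ultimately show "openin (top_of_set cartan) I" unfolding openin_open by blast
  next
    fix U assume U: "U \<subseteq> ?A" "openin (top_of_set cartan) U"
    show "U \<subseteq> I"
    proof
      fix x assume x: "x \<in> U"
      from U(2) x obtain \<epsilon> where \<epsilon>: "\<epsilon> > 0" "ball x \<epsilon> \<inter> cartan \<subseteq> U"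
        by (auto simp: openin_contains_ball)
      have xA: "x \<in> ?A" using U(1) x by blast
      then have xc: "x \<in> cartan" by (simp add: A)
      have move: "\<exists>t>0. x + t *\<^sub>R v \<in> ?A" if v: "v \<in> cartan" for v
      proof -
        \<comment> \<open>Adding 1 keeps the denominator positive when \<open>v = 0\<close>; the
          displacement is at most \<open>\<epsilon> / 2\<close>.\<close>
        let ?t = "\<epsilon> / (2 * (norm v + 1))"
        have t: "?t > 0" using \<epsilon>(1) by (simp add: add_nonneg_pos)
        have "norm v + 1 > 0" by (simp add: add_nonneg_pos)
        moreover have "\<epsilon> / (2 * K) * K = \<epsilon> / 2" if "K > 0" for K :: real using that by simp
        ultimately have "?t * (norm v + 1) = \<epsilon> / 2" by blast
        moreover have "?t * norm v \<le> ?t * (norm v + 1)"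
          using t by (intro mult_left_mono) auto
        ultimately have "x + ?t *\<^sub>R v \<in> ball x \<epsilon>"
          using \<epsilon>(1) t by (simp add: dist_norm)
        moreover have "x + ?t *\<^sub>R v \<in> cartan"
          using xc v by (intro subspace_add[OF cartan_subspace] subspace_scale[OF cartan_subspace])
        ultimately show ?thesis using \<epsilon>(2) U(1) t by blast
      qed
      have "x $ i > x $ j" if ij: "r i < r j" for i j
      proof -
        \<comment> \<open>This move lowers \<open>x $ i - x $ j\<close> by \<open>2 * t\<close>, and
          the result is still nonnegative.\<close>
        obtain t where "t > 0" "x + t *\<^sub>R root_vec j i \<in> ?A"
          using move root_vec_cartan by blast
        moreover have "i \<noteq> j" using ij by auto
        ultimately show ?thesis using ij by (force simp: A axis_def)
      qed
      moreover have "x $ a - x $ z < real m"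
      proof -
        obtain t where "t > 0" "x + t *\<^sub>R root_vec a z \<in> ?A"
          using move root_vec_cartan by blast
        moreover have "a \<noteq> z" using r(3) by auto
        ultimately show ?thesis by (force simp: A axis_def)
      qed
      ultimately show "x \<in> I" using xc by (simp add: I_def)
    qed
  qed
  then show ?thesis
    unfolding regular_weights_def span_weight_lattice by (auto simp: I_def weight_lattice_eq)
qed

section \<open>Denominators that are powers of a prime\<close>

text \<open>The ring \<open>\<int>[1/p]\<close>.\<close>

definition p_integral :: "nat \<Rightarrow> real set" where
  "p_integral p = {x. \<exists>k. real p ^ k * x \<in> \<int>}"

text \<open>A fraction with denominator \<open>p ^ k\<close> need not be reduced, but its reduced
  denominator divides \<open>p ^ k\<close> and is therefore again a power of the prime
  \<open>p\<close>.\<close>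

lemma p_power_denominator_iff:
  assumes "prime p"
  shows "p_power_denominator p x \<longleftrightarrow> x \<in> p_integral p"
proof
  assume "p_power_denominator p x"
  then obtain q k where x: "x = of_rat q" and k: "snd (quotient_of q) = int p ^ k"
    by (auto simp: p_power_denominator_def)
  obtain u where "quotient_of q = (u, int p ^ k)" using k by (metis prod.collapse)
  then have "q = of_int u / of_int (int p ^ k)" by (rule quotient_of_div)
  then have "real p ^ k * x = of_int u"
    using prime_gt_0_nat[OF assms] by (simp add: x of_rat_divide of_rat_power)
  then show "x \<in> p_integral p" unfolding p_integral_def by (metis Ints_of_int mem_Collect_eq)
next
  assume "x \<in> p_integral p"
  then obtain k u where "real p ^ k * x = of_int u"
    by (auto simp: p_integral_def elim: Ints_cases)
  then have x: "x = of_int u / of_int (int p ^ k)"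
    using prime_gt_0_nat[OF assms] by (simp add: field_simps)
  have pos: "int p ^ k > 0" using prime_gt_0_nat[OF assms] by simp
  have "snd (quotient_of (Fract u (int p ^ k))) = int p ^ k div gcd u (int p ^ k)"
    using pos by (simp add: quotient_of_Fract Rat.normalize_def Let_def)
  moreover obtain d where d: "d = int p ^ k div gcd u (int p ^ k)" by blast
  have "d dvd int p ^ k" unfolding d by (metis dvd_triv_left dvd_mult_div_cancel gcd_dvd2 dvd_div_mult_self)
  moreover have "d \<ge> 0" unfolding d using pos by (simp add: pos_imp_zdiv_nonneg_iff)
  ultimately have "\<exists>j. snd (quotient_of (Fract u (int p ^ k))) = int p ^ j"
    using divides_primepow[of "int p" d k] assms unfolding d by auto
  moreover have "x = of_rat (Fract u (int p ^ k))"
    using pos by (simp add: x of_rat_rat)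
  ultimately show "p_power_denominator p x" unfolding p_power_denominator_def by blast
qed

section \<open>Arithmetic and divisibility in the ring of fractions with \<open>p\<close>-power
  denominators\<close>

lemma p_integral_of_int: "of_int c \<in> p_integral p"
  unfolding p_integral_def by (auto intro!: exI[of _ 0])

lemma p_integral_add: "x + y \<in> p_integral p" if "x \<in> p_integral p" "y \<in> p_integral p"
proof -
  from that obtain j k where "real p ^ j * x \<in> \<int>" "real p ^ k * y \<in> \<int>"
    unfolding p_integral_def by blast
  then have "real p ^ k * (real p ^ j * x) + real p ^ j * (real p ^ k * y) \<in> \<int>"
    by - (rule Ints_add[OF Ints_mult Ints_mult]; simp)
  then have "real p ^ (j + k) * (x + y) \<in> \<int>"
    by (simp add: power_add algebra_simps)
  then show ?thesis by (auto simp: p_integral_def)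
qed

lemma p_integral_mult_of_int: "of_int c * x \<in> p_integral p" if "x \<in> p_integral p"
proof -
  from that obtain k where "real p ^ k * x \<in> \<int>" unfolding p_integral_def by blast
  then have "of_int c * (real p ^ k * x) \<in> \<int>" by (rule Ints_mult[OF Ints_of_int])
  then show ?thesis unfolding p_integral_def by (auto simp: mult_ac)
qed

lemma p_integral_minus: "- x \<in> p_integral p" if "x \<in> p_integral p"
  using p_integral_mult_of_int[OF that, of "-1"] by simp

lemma p_integral_diff: "x - y \<in> p_integral p" if "x \<in> p_integral p" "y \<in> p_integral p"
  using p_integral_add[OF that(1) p_integral_minus[OF that(2)]] by simp

lemma p_integral_sum: "(\<And>i. i \<in> A \<Longrightarrow> f i \<in> p_integral p) \<Longrightarrow> sum f A \<in> p_integral p"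
  by (induction A rule: infinite_finite_induct)
     (use p_integral_of_int[of 0 p] in \<open>auto intro: p_integral_add\<close>)

text \<open>Powers of \<open>p\<close> are units of the ring.\<close>

lemma p_integral_divide_power:
  assumes "p > 0"
  shows "x / real p ^ k \<in> p_integral p \<longleftrightarrow> x \<in> p_integral p"
proof
  assume "x / real p ^ k \<in> p_integral p"
  then have "of_int (int p ^ k) * (x / real p ^ k) \<in> p_integral p" by (rule p_integral_mult_of_int)
  then show "x \<in> p_integral p" using assms by simp
next
  assume "x \<in> p_integral p"
  then obtain j where "real p ^ j * x \<in> \<int>" unfolding p_integral_def by blast
  then have "real p ^ (j + k) * (x / real p ^ k) \<in> \<int>" using assms by (simp add: power_add)
  then show "x / real p ^ k \<in> p_integral p" by (auto simp: p_integral_def)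
qed

text \<open>Clearing denominators gives \<open>int q dvd int p ^ k * c\<close>, and \<open>q\<close>
  is coprime to \<open>p\<close>.\<close>

lemma p_integral_divide_iff:
  assumes "prime p" "\<not> p dvd q"
  shows "of_int c / real q \<in> p_integral p \<longleftrightarrow> int q dvd c"
proof
  have q: "q > 0" using assms(2) by (cases q) auto
  assume "of_int c / real q \<in> p_integral p"
  then obtain k u where "real p ^ k * (of_int c / real q) = of_int u"
    by (auto simp: p_integral_def elim: Ints_cases)
  then have "real_of_int (int p ^ k * c) = real_of_int (u * int q)" using q by (simp add: field_simps)
  then have "int p ^ k * c = u * int q" by linarith
  then have "int q dvd int p ^ k * c" by simp
  moreover have "coprime q (p ^ k)"
    using assms by (simp add: coprime_commute prime_imp_coprime)
  then have "coprime (int q) (int p ^ k)" by (metis coprime_int_iff of_nat_power)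
  ultimately show "int q dvd c" by (simp add: coprime_dvd_mult_right_iff)
next
  have q: "q > 0" using assms(2) by (cases q) auto
  assume "int q dvd c"
  then obtain u where "c = int q * u" by blast
  then show "of_int c / real q \<in> p_integral p" using q p_integral_of_int[of u p] by simp
qed

text \<open>Projected coordinate vectors are weights that read off the coordinates of \<mu>.
  Conversely, every weight pairs with \<mu> as an integral combination of these coordinates.\<close>

lemma p_integral_pairing_iff:
  fixes \<mu> :: "real^'k::finite"
  assumes "\<mu> \<in> cartan"
  shows "(\<forall>w\<in>weight_lattice. (w \<bullet> \<mu>) / c \<in> p_integral p) \<longleftrightarrow> (\<forall>i. \<mu> $ i / c \<in> p_integral p)"
proof (intro iffI allI ballI)
  fix i :: 'k
  assume *: "\<forall>w\<in>weight_lattice. (w \<bullet> \<mu>) / c \<in> p_integral p"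
  \<comment> \<open>the projection of \<open>axis i 1\<close> to \<open>cartan\<close>\<close>
  define w :: "real^'k" where "w = (\<chi> j. (if j = i then 1 else 0) - 1 / CARD('k))"
  have "w \<in> weight_lattice"
    by (auto simp: w_def weight_lattice_eq cartan_def sum_subtractf)
  moreover have "w \<bullet> \<mu> = \<mu> $ i"
    using assms by (simp add: w_def inner_vec_def cartan_def left_diff_distrib sum_subtractf
        if_distrib[of "\<lambda>x. x * _"] flip: sum_divide_distrib cong: if_cong)
  ultimately show "\<mu> $ i / c \<in> p_integral p" using * by metis
next
  fix w :: "real^'k"
  assume *: "\<forall>i. \<mu> $ i / c \<in> p_integral p" and "w \<in> weight_lattice"
  then have int: "\<And>i j. w $ i - w $ j \<in> \<int>" by (simp add: weight_lattice_eq)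
  fix k :: 'k
  \<comment> \<open>Subtracting the constant \<open>w $ k\<close> costs nothing because \<mu> has
    trace zero, and it makes the coefficients integral.\<close>
  have "w \<bullet> \<mu> = (\<Sum>i\<in>UNIV. (w $ i - w $ k) * \<mu> $ i)"
    using assms by (simp add: inner_vec_def cartan_def left_diff_distrib sum_subtractf
        flip: sum_distrib_left)
  then have "(w \<bullet> \<mu>) / c = (\<Sum>i\<in>UNIV. (w $ i - w $ k) * (\<mu> $ i / c))"
    by (simp add: sum_divide_distrib)
  also have "\<dots> \<in> p_integral p"
  proof (rule p_integral_sum)
    fix i
    obtain u where "w $ i - w $ k = of_int u" using int[of i k] by (auto elim: Ints_cases)
    then show "(w $ i - w $ k) * (\<mu> $ i / c) \<in> p_integral p"
      using * by (simp add: p_integral_mult_of_int del: times_divide_eq_right)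
  qed
  finally show "(w \<bullet> \<mu>) / c \<in> p_integral p" .
qed

section \<open>The count\<close>

theorem mainTheorem2:
  fixes n m p i m' l n' :: nat
    and Rp :: "(real^'k::finite) set"
    and B :: "real^'k \<Rightarrow> real^'k \<Rightarrow> real"
  assumes "n \<ge> 1" and "CARD('k) = n + 1"
    and "m > 0" and "prime p"
    and "m = p ^ i * m'" and "\<not> p dvd m'"
    and "n + 1 = p ^ l * n'" and "\<not> p dvd n'"
    and "positive_system (roots :: (real^'k) set) Rp"
    and "basic_inner_product (weight_lattice :: (real^'k) set) roots weyl_group B"
  shows "N weight_lattice Rp B m p =
    card {b :: int list. length b = n \<and> sorted_wrt (>) (int p ^ i # b @ [0]) \<and>
                         int n' dvd sum_list b}"
proof -
  let ?P = "weight_lattice :: (real^'k) set"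
  define T where "T = {b :: int list. length b = n \<and> sorted_wrt (>) (int p ^ i # b @ [0]) \<and>
                         int n' dvd sum_list b}"
  have p: "p > 0" using assms(4) prime_gt_0_nat by blast
  have m': "m' > 0" using assms(3,5) by (cases m') auto
  have m_real: "real m = real p ^ i * real m'" using assms(5) by simp
  have N_real: "real n + 1 = real p ^ l * real n'" using assms(7) by (metis of_nat_Suc Suc_eq_plus1 of_nat_mult of_nat_power add.commute)
  have card: "real CARD('k) = real n + 1" and N0: "real n + 1 \<noteq> 0" using assms(2) by auto
  obtain r :: "'k \<Rightarrow> nat" where r: "bij_betw r UNIV {..<n + 1}"
    and Rp: "Rp = {root_vec i j |i j. r i < r j}"
    by (rule positive_system_rank[OF assms(9), unfolded assms(2)])
  have inj: "inj r" using r by (simp add: bij_betw_def)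
  define s where "s = inv r"
  have sr [simp]: "s (r j) = j" for j using inj by (simp add: s_def)
  have rs: "r (s j) = j" if "j \<le> n" for j
    using r that unfolding s_def by (intro f_inv_into_f) (auto simp: bij_betw_def)
  have r_le: "r j \<le> n" for j
    using bij_betw_apply[OF r, of j] by simp
  \<comment> \<open>The indices of the largest and the smallest coordinate of a regular
    weight.\<close>
  define a z where "a = s 0" and "z = s n"
  have ra: "r a = 0" and rz: "r z = n" by (simp_all add: a_def z_def rs)
  have B: "B x y = x \<bullet> y" if "x \<in> cartan" "y \<in> cartan" for x y
    using basic_inner_product_eq_inner[OF assms(10) that] .
  have reg: "regular_weights ?P Rp B m =
    {\<mu> \<in> ?P. (\<forall>i j. r i < r j \<longrightarrow> \<mu> $ i > \<mu> $ j) \<and> \<mu> $ a - \<mu> $ z < real m}"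
    by (rule regular_weights_eq[OF Rp inj _ _ _ B]) (use assms(1) ra rz r_le in auto)
  define L where "L = {\<mu> \<in> ?P. (\<forall>i j. r i < r j \<longrightarrow> \<mu> $ i > \<mu> $ j) \<and> \<mu> $ a - \<mu> $ z < real m \<and>
    (\<forall>i. \<mu> $ i / real m \<in> p_integral p)}"
  have P_cartan: "\<mu> \<in> cartan" if "\<mu> \<in> ?P" for \<mu> using that by (simp add: weight_lattice_eq)
  have "(\<forall>w\<in>?P. p_power_denominator p (B w \<mu> / real m)) \<longleftrightarrow> (\<forall>i. \<mu> $ i / real m \<in> p_integral p)"
    if "\<mu> \<in> ?P" for \<mu>
    using p_integral_pairing_iff[OF P_cartan[OF that], of "real m" p] P_cartan that
    by (simp add: p_power_denominator_iff[OF assms(4)] B)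
  then have L: "{\<mu> \<in> regular_weights ?P Rp B m. \<forall>w\<in>?P. p_power_denominator p (B w \<mu> / real m)} = L"
    unfolding reg L_def by blast
  \<comment> \<open>The appended 0 belongs to the smallest coordinate \<open>z\<close>, of rank
    \<open>n\<close>. Subtracting the mean of the \<open>n + 1\<close> entries brings the vector
    into \<open>cartan\<close>.\<close>
  define F :: "int list \<Rightarrow> real^'k" where
    "F b = (\<chi> j. real m' * (of_int ((b @ [0]) ! r j) - of_int (sum_list b) / (real n + 1)))" for b
  have sum_r: "(\<Sum>j\<in>UNIV. g (r j)) = (\<Sum>j<n + 1. g j)" for g :: "nat \<Rightarrow> real"
    using sum.reindex_bij_betw[OF r] by blast
  have sum_b: "(\<Sum>j\<in>UNIV. of_int ((b @ [0]) ! r j)) = real_of_int (sum_list b)" if "length b = n" for b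
  proof -
    have "sum_list (b @ [0]) = (\<Sum>j<n + 1. (b @ [0]) ! j)"
      using that by (subst sum_list_sum_nth) (simp add: atLeast0LessThan)
    then show ?thesis by (subst sum_r[where g = "\<lambda>j. of_int ((b @ [0]) ! j)"]) simp
  qed
  \<comment> \<open>In a strictly decreasing list the upper bound has to be checked at the first
    entry only; the remaining order is transported along the ranks.\<close>
  have sorted_iff: "sorted_wrt (>) (int p ^ i # b @ [0]) \<longleftrightarrow>
      (\<forall>j k. r j < r k \<longrightarrow> (b @ [0]) ! r j > (b @ [0]) ! r k) \<and> (b @ [0]) ! 0 < int p ^ i"
    if b: "length b = n" for b :: "int list"
  proof -
    let ?b = "b @ [0]"
    have "(\<forall>j k. r j < r k \<longrightarrow> ?b ! r j > ?b ! r k) \<longleftrightarrow> (\<forall>j k. j < k \<and> k \<le> n \<longrightarrow> ?b ! j > ?b ! k)"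
    proof (intro iffI allI impI)
      fix j k assume *: "\<forall>j k. r j < r k \<longrightarrow> ?b ! r j > ?b ! r k" and "j < k \<and> k \<le> n"
      then have "r (s j) = j" "r (s k) = k" "j < k" by (simp_all add: rs)
      with * show "?b ! j > ?b ! k" by metis
    qed (use r_le in blast)
    also have "\<dots> \<longleftrightarrow> sorted_wrt (>) ?b"
      using b by (auto simp: sorted_wrt_iff_nth_less)
    finally have 1: "(\<forall>j k. r j < r k \<longrightarrow> ?b ! r j > ?b ! r k) \<longleftrightarrow> sorted_wrt (>) ?b" .
    have 2: "(\<forall>x\<in>set ?b. x < int p ^ i) \<longleftrightarrow> ?b ! 0 < int p ^ i" if "sorted_wrt (>) ?b"
    proof
      assume 0: "?b ! 0 < int p ^ i"
      show "\<forall>x\<in>set ?b. x < int p ^ i"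
      proof
        fix x assume "x \<in> set ?b"
        then obtain j where "j < length ?b" "x = ?b ! j" by (metis in_set_conv_nth)
        with 0 that show "x < int p ^ i"
          using sorted_wrt_nth_less[OF that, of 0 j] by (cases "j = 0") auto
      qed
    qed (metis nth_mem length_append_singleton zero_less_Suc)
    have "sorted_wrt (>) (int p ^ i # ?b) \<longleftrightarrow> (\<forall>x\<in>set ?b. x < int p ^ i) \<and> sorted_wrt (>) ?b"
      by (simp only: sorted_wrt.simps)
    with 1 2 show ?thesis by blast
  qed
  have "bij_betw F T L"
    unfolding bij_betw_def
  proof (intro conjI inj_onI equalityI subsetI)
    fix b c assume bc: "b \<in> T" "c \<in> T" and eq: "F b = F c"
    have len: "length b = n" "length c = n" using bc by (auto simp: T_def)
    have comp: "of_int ((b @ [0]) ! r j) - of_int (sum_list b) / (real n + 1) =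
        of_int ((c @ [0]) ! r j) - of_int (sum_list c) / (real n + 1)" for j
      using arg_cong[OF eq, of "\<lambda>x. x $ j"] m' by (simp add: F_def)
    \<comment> \<open>At \<open>z\<close> both lists contribute the appended 0, so only the means
      remain to be compared.\<close>
    have "sum_list b = sum_list c"
      using comp[of z] len by (simp add: rz nth_append field_simps)
    then have nth: "(b @ [0]) ! r j = (c @ [0]) ! r j" for j
      using comp[of j] by simp
    show "b = c"
    proof (rule nth_equalityI)
      fix j assume "j < length b"
      then show "b ! j = c ! j"
        using nth[of "s j"] len by (simp add: rs nth_append)
    qed (use len in simp)
  next
    fix \<mu> assume "\<mu> \<in> F ` T"
    then obtain b where b: "b \<in> T" and \<mu>: "\<mu> = F b" by blast
    have len: "length b = n" and dvd: "int n' dvd sum_list b"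
      and sorted: "\<And>j k. r j < r k \<Longrightarrow> (b @ [0]) ! r j > (b @ [0]) ! r k" "(b @ [0]) ! 0 < int p ^ i"
      using b sorted_iff[of b] by (auto simp: T_def)
    have diff: "\<mu> $ j - \<mu> $ k = real m' * of_int ((b @ [0]) ! r j - (b @ [0]) ! r k)" for j k
      by (simp add: \<mu> F_def algebra_simps)
    have "(\<Sum>j\<in>UNIV. \<mu> $ j) = real m' * ((\<Sum>j\<in>UNIV. of_int ((b @ [0]) ! r j)) - of_int (sum_list b))"
      by (simp add: \<mu> F_def sum_subtractf card N0 flip: sum_distrib_left)
    then have "\<mu> \<in> cartan" by (simp add: sum_b len cartan_def)
    moreover have "\<mu> $ j - \<mu> $ k \<in> \<int>" for j k
      unfolding diff by (intro Ints_mult) auto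
    ultimately have "\<mu> \<in> ?P" by (simp add: weight_lattice_eq)
    moreover have "\<mu> $ j > \<mu> $ k" if "r j < r k" for j k
    proof -
      have "\<mu> $ j - \<mu> $ k > 0"
        unfolding diff using sorted(1)[OF that] m' by simp
      then show ?thesis by simp
    qed
    moreover have "\<mu> $ a - \<mu> $ z < real m"
    proof -
      \<comment> \<open>The difference of the extreme coordinates is \<open>m'\<close> times the
        first entry of \<open>b\<close>, and \<open>m = p ^ i * m'\<close>.\<close>
      have "real_of_int ((b @ [0]) ! 0) < of_int (int p ^ i)" using sorted(2) by (simp only: of_int_less_iff)
      then show ?thesis using m' unfolding diff m_real ra rz by (simp add: nth_append len mult.commute)
    qed
    moreover have "\<mu> $ j / real m \<in> p_integral p" for j
    proof -
      \<comment> \<open>The factor \<open>m'\<close> cancels; the powers of \<open>p\<close> are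
        units, so only divisibility of the sum by \<open>n'\<close> matters.\<close>
      have "\<mu> $ j / real m = (of_int ((b @ [0]) ! r j) - of_int (sum_list b) / real n' / real p ^ l) / real p ^ i"
        using m' by (simp add: \<mu> F_def m_real N_real mult.commute)
      also have "\<dots> \<in> p_integral p"
        unfolding p_integral_divide_power[OF p]
        by (rule p_integral_diff[OF p_integral_of_int])
           (simp only: p_integral_divide_power[OF p] p_integral_divide_iff[OF assms(4,8)] dvd)
      finally show ?thesis .
    qed
    ultimately show "\<mu> \<in> L" by (simp add: L_def)
  next
    fix \<mu> assume \<mu>: "\<mu> \<in> L"
    then have int: "\<And>j k. \<mu> $ j - \<mu> $ k \<in> \<int>" and sum0: "(\<Sum>j\<in>UNIV. \<mu> $ j) = 0"
      and ord: "\<And>j k. r j < r k \<Longrightarrow> \<mu> $ j > \<mu> $ k" and less: "\<mu> $ a - \<mu> $ z < real m"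
      and pint: "\<And>j. \<mu> $ j / real m \<in> p_integral p"
      by (auto simp: L_def weight_lattice_eq cartan_def)
    \<comment> \<open>An integral difference divided by \<open>m\<close> lies in the ring only if
      \<open>m'\<close>, the part of \<open>m\<close> prime to \<open>p\<close>, divides it.\<close>
    have "\<exists>e. \<mu> $ j - \<mu> $ z = real m' * of_int e" for j
    proof -
      obtain d where d: "\<mu> $ j - \<mu> $ z = of_int d" using int by (blast elim: Ints_cases)
      have "of_int d / real m' / real p ^ i = \<mu> $ j / real m - \<mu> $ z / real m"
        by (simp add: m_real flip: d diff_divide_distrib)
      also have "\<dots> \<in> p_integral p" using pint by (intro p_integral_diff)
      finally have "int m' dvd d"
        by (simp only: p_integral_divide_power[OF p] p_integral_divide_iff[OF assms(4,6)])
      then obtain e where "d = int m' * e" by blast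
      then show ?thesis using d by auto
    qed
    then obtain e where e: "\<And>j. \<mu> $ j - \<mu> $ z = real m' * of_int (e j)" by metis
    have ez: "e z = 0" using e[of z] m' by simp
    \<comment> \<open>The quotients in rank order; rank \<open>n\<close> is left out because
      \<open>e z = 0\<close>.\<close>
    define b where "b = map (\<lambda>j. e (s j)) [0..<n]"
    have len: "length b = n" by (simp add: b_def)
    have nth: "(b @ [0]) ! r j = e j" for j
    proof (cases "r j = n")
      case True
      then have "j = z" using rz inj by (metis injD)
      then show ?thesis by (simp add: rz nth_append len ez)
    next
      case False
      then show ?thesis using r_le[of j] by (simp add: nth_append len) (simp add: b_def)
    qed
    \<comment> \<open>Trace zero recovers the smallest coordinate from the differences.\<close>
    have "0 = (\<Sum>j\<in>UNIV. (\<mu> $ j - \<mu> $ z) + \<mu> $ z)" using sum0 by simp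
    also have "\<dots> = real m' * (\<Sum>j\<in>UNIV. of_int (e j)) + (real n + 1) * \<mu> $ z"
      unfolding sum.distrib e by (simp add: sum_distrib_left card)
    also have "(\<Sum>j\<in>UNIV. of_int (e j)) = real_of_int (sum_list b)"
      using sum_b[OF len] by (simp add: nth)
    finally have muz: "\<mu> $ z = - (real m' * of_int (sum_list b) / (real n + 1))"
      by (simp add: field_simps)
    have "F b = \<mu>"
      using e muz by (simp add: F_def vec_eq_iff nth right_diff_distrib) (metis diff_add_cancel uminus_add_conv_diff add.commute)
    moreover have "b \<in> T"
    proof -
      have "e j > e k" if "r j < r k" for j k
      proof -
        have "real m' * of_int (e j) > real m' * of_int (e k)"
          using ord[OF that] by (simp flip: e)
        then show ?thesis using m' by simp
      qed
      moreover have "(b @ [0]) ! 0 < int p ^ i"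
      proof -
        have "real m' * of_int (e a) < real m' * real p ^ i"
          using less by (simp add: m_real e mult.commute)
        then have "real_of_int (e a) < of_int (int p ^ i)" using m' by simp
        then show ?thesis using nth[of a] by (simp only: ra of_int_less_iff)
      qed
      moreover have "int n' dvd sum_list b"
      proof -
        \<comment> \<open>Conversely, the denominator condition at the smallest coordinate alone
          gives the divisibility by \<open>n'\<close>.\<close>
        have "of_int (- sum_list b) / real n' / real p ^ l / real p ^ i = \<mu> $ z / real m"
          using m' by (simp add: muz m_real N_real mult_ac)
        with pint[of z] have "of_int (- sum_list b) / real n' / real p ^ l / real p ^ i \<in> p_integral p"
          by metis
        then have "int n' dvd - sum_list b"
          by (simp only: p_integral_divide_power[OF p] p_integral_divide_iff[OF assms(4,8)])
        then show ?thesis by simp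
      qed
      ultimately show ?thesis
        unfolding T_def using sorted_iff[OF len] len by (simp only: nth) simp
    qed
    ultimately show "\<mu> \<in> F ` T" by blast
  qed
  then have "card T = card L" by (rule bij_betw_same_card)
  then show ?thesis by (simp add: N_def L T_def)
qed

end
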